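(* Let $K\ge 1$, $N_t,N_r,N_d\ge1$ be integers, $\sigma_0^2>0$, $P_{\rm BS}>0$, and weights $\omega_1,\dots,\omega_K>0$ with $\sum_k\omega_k=1$. Let $\mathbf{H}_k\in\mathbb{C}^{N_r\times N_t}$ ($k=1,\dots,K$), $\mathbf{H}=[\mathbf{H}_1^{\mathsf T},\dots,\mathbf{H}_K^{\mathsf T}]^{\mathsf T}\in\mathbb{C}^{KN_r\times N_t}$, $\bar{\mathbf{H}}=\mathbf{H}\mathbf{H}^{\mathsf H}\in\mathbb{C}^{KN_r\times KN_r}$ and $\bar{\mathbf{H}}_k=\mathbf{H}_k\mathbf{H}^{\mathsf H}\in\mathbb{C}^{N_r\times KN_r}$. Fix a point $\mathbf{F}^{(n)}=[\mathbf{F}^{(n)}_1,\dots,\mathbf{F}^{(n)}_K]$ with $\mathbf{F}^{(n)}_k\in\mathbb{C}^{KN_r\times N_d}$ and define $\hat{\mathbf{X}}_k=\bar{\mathbf{H}}_k\mathbf{F}_k^{(n)}$, $$\hat{\mathbf{Y}}_k=\sum_{j\neq k}\bar{\mathbf{H}}_k\mathbf{F}_j^{(n)}(\mathbf{F}_j^{(n)})^{\mathsf H}\bar{\mathbf{H}}_k^{\mathsf H}+\frac{\sigma_0^2}{P_{\rm BS}}\sum_{i=1}^K\mathrm{Tr}\big(\bar{\mathbf{H}}\mathbf{F}_i^{(n)}(\mathbf{F}_i^{(n)})^{\mathsf H}\big)\mathbf{I},$$ assumed invertible, $\hat{\mathbf{B}}_k=\hat{\mathbf{X}}_k^{\mathsf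 H}\hat{\mathbf{Y}}_k^{-1}$ and $\hat{\mathbf{A}}_k=\hat{\mathbf{Y}}_k^{-1}-(\hat{\mathbf{X}}_k\hat{\mathbf{X}}_k^{\mathsf H}+\hat{\mathbf{Y}}_k)^{-1}$. For $\mathbf{F}=[\mathbf{F}_1,\dots,\mathbf{F}_K]$, $\mathbf{F}_k\in\mathbb{C}^{KN_r\times N_d}$, define $$g_k(\mathbf{F})=\log\det(\mathbf{I}+\hat{\mathbf{B}}_k\hat{\mathbf{X}}_k)-\mathrm{Tr}(\hat{\mathbf{B}}_k\hat{\mathbf{X}}_k)+2\Re\{\mathrm{Tr}(\hat{\mathbf{B}}_k\bar{\mathbf{H}}_k\mathbf{F}_k)\}-\sum_{j=1}^K\mathrm{Tr}(\mathbf{F}_j^{\mathsf H}\bar{\mathbf{H}}_k^{\mathsf H}\hat{\mathbf{A}}_k^{\mathsf H}\bar{\mathbf{H}}_k\mathbf{F}_j)-\frac{\sigma_0^2}{P_{\rm BS}}\mathrm{Tr}(\hat{\mathbf{A}}_k^{\mathsf H})\sum_{i=1}^K\mathrm{Tr}(\bar{\mathbf{H}}\mathbf{F}_i\mathbf{F}_i^{\mathsf H}).$$ Then the closed-form solution of $\max_{\mathbf{F}}\sum_{k=1}^K\omega_k g_k(\mathbf{F})$ is $$\mathbf{F}=(\mu\mathbf{I}+\tilde{\mathbf{A}}\bar{\mathbf{H}})^{-1}\tilde{\mathbf{B}},$$ where $\tilde{\mathbf{A}}=\mathrm{blkdiag}(\omega_1\hat{\mathbf{A}}_1^{\mathsf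 H},\dots,\omega_K\hat{\mathbf{A}}_K^{\mathsf H})$, $\tilde{\mathbf{B}}=\mathrm{blkdiag}(\omega_1\hat{\mathbf{B}}_1^{\mathsf H},\dots,\omega_K\hat{\mathbf{B}}_K^{\mathsf H})$ and $\mu=\frac{\sigma_0^2}{P_{\rm BS}}\sum_{k=1}^K\omega_k\mathrm{Tr}(\hat{\mathbf{A}}_k^{\mathsf H})$.
   Context: This is the precoder-update subproblem of successive convex approximation for weighted sum-rate maximization in a downlink multiuser MIMO system (with RIS phase shifts fixed), where $\mathbf{H}_k$ is the composite channel to user $k$. $\mathrm{blkdiag}$ denotes the block-diagonal matrix with the given diagonal blocks; $\log$ is the natural logarithm; $^{\mathsf H}$ is conjugate transpose. *)

theory Defs
  imports "HOL-Analysis.Complex_Transcendental" "Jordan_Normal_Form.Determinant"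
begin

definition ctr :: "complex mat \<Rightarrow> complex mat" where
  "ctr A = mat (dim_col A) (dim_row A) (\<lambda>(i,j). cnj (A $$ (j,i)))"

definition mtrace :: "complex mat \<Rightarrow> complex" where
  "mtrace A = (\<Sum>i<dim_row A. A $$ (i,i))"

definition msum :: "nat \<Rightarrow> nat \<Rightarrow> (nat \<Rightarrow> complex mat) \<Rightarrow> nat set \<Rightarrow> complex mat" where
  "msum n m f S = mat n m (\<lambda>(i,j). \<Sum>k\<in>S. f k $$ (i,j))"

definition minv :: "complex mat \<Rightarrow> complex mat" where
  "minv A = (if invertible_mat A
             then (SOME B. inverts_mat A B \<and> inverts_mat B A)
             else 0\<^sub>m (dim_row A) (dim_row A))"

text \<open>Users are indexed 0,...,K-1.  Hs k is H_k (Nr x Nt).\<close>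

definition Hstack :: "nat \<Rightarrow> nat \<Rightarrow> nat \<Rightarrow> (nat \<Rightarrow> complex mat) \<Rightarrow> complex mat" where
  "Hstack K Nr Nt Hs = mat (K*Nr) Nt (\<lambda>(i,j). Hs (i div Nr) $$ (i mod Nr, j))"

definition Hbar :: "nat \<Rightarrow> nat \<Rightarrow> nat \<Rightarrow> (nat \<Rightarrow> complex mat) \<Rightarrow> complex mat" where
  "Hbar K Nr Nt Hs = Hstack K Nr Nt Hs * ctr (Hstack K Nr Nt Hs)"

definition Hbark :: "nat \<Rightarrow> nat \<Rightarrow> nat \<Rightarrow> (nat \<Rightarrow> complex mat) \<Rightarrow> nat \<Rightarrow> complex mat" where
  "Hbark K Nr Nt Hs k = Hs k * ctr (Hstack K Nr Nt Hs)"

definition Xhat :: "nat \<Rightarrow> nat \<Rightarrow> nat \<Rightarrow> (nat \<Rightarrow> complex mat) \<Rightarrow> (nat \<Rightarrow> complex mat) \<Rightarrow> nat \<Rightarrow> complex mat" where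
  "Xhat K Nr Nt Hs Fn k = Hbark K Nr Nt Hs k * Fn k"

text \<open>c stands for sigma_0^2 / P_BS.\<close>

definition Yhat :: "nat \<Rightarrow> nat \<Rightarrow> nat \<Rightarrow> (nat \<Rightarrow> complex mat) \<Rightarrow> real \<Rightarrow> (nat \<Rightarrow> complex mat) \<Rightarrow> nat \<Rightarrow> complex mat" where
  "Yhat K Nr Nt Hs c Fn k =
     msum Nr Nr (\<lambda>j. Hbark K Nr Nt Hs k * Fn j * ctr (Fn j) * ctr (Hbark K Nr Nt Hs k)) ({0..<K} - {k})
     + (complex_of_real c * (\<Sum>i<K. mtrace (Hbar K Nr Nt Hs * Fn i * ctr (Fn i)))) \<cdot>\<^sub>m 1\<^sub>m Nr"

definition Bhat :: "nat \<Rightarrow> nat \<Rightarrow> nat \<Rightarrow> (nat \<Rightarrow> complex mat) \<Rightarrow> real \<Rightarrow> (nat \<Rightarrow> complex mat) \<Rightarrow> nat \<Rightarrow> complex mat" where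
  "Bhat K Nr Nt Hs c Fn k = ctr (Xhat K Nr Nt Hs Fn k) * minv (Yhat K Nr Nt Hs c Fn k)"

definition Ahat :: "nat \<Rightarrow> nat \<Rightarrow> nat \<Rightarrow> (nat \<Rightarrow> complex mat) \<Rightarrow> real \<Rightarrow> (nat \<Rightarrow> complex mat) \<Rightarrow> nat \<Rightarrow> complex mat" where
  "Ahat K Nr Nt Hs c Fn k = minv (Yhat K Nr Nt Hs c Fn k)
     - minv (Xhat K Nr Nt Hs Fn k * ctr (Xhat K Nr Nt Hs Fn k) + Yhat K Nr Nt Hs c Fn k)"

definition gk :: "nat \<Rightarrow> nat \<Rightarrow> nat \<Rightarrow> nat \<Rightarrow> (nat \<Rightarrow> complex mat) \<Rightarrow> real \<Rightarrow> (nat \<Rightarrow> complex mat)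
                  \<Rightarrow> nat \<Rightarrow> (nat \<Rightarrow> complex mat) \<Rightarrow> complex" where
  "gk K Nr Nt Nd Hs c Fn k F =
     (let Hk = Hbark K Nr Nt Hs k; Hb = Hbar K Nr Nt Hs;
          X = Xhat K Nr Nt Hs Fn k; B = Bhat K Nr Nt Hs c Fn k; A = Ahat K Nr Nt Hs c Fn k
      in Ln (det (1\<^sub>m Nd + B * X)) - mtrace (B * X)
         + 2 * complex_of_real (Re (mtrace (B * Hk * F k)))
         - (\<Sum>j<K. mtrace (ctr (F j) * ctr Hk * ctr A * Hk * F j))
         - complex_of_real c * mtrace (ctr A) * (\<Sum>i<K. mtrace (Hb * F i * ctr (F i))))"

definition objective :: "nat \<Rightarrow> nat \<Rightarrow> nat \<Rightarrow> nat \<Rightarrow> (nat \<Rightarrow> complex mat) \<Rightarrow> real \<Rightarrow> (nat \<Rightarrow> complex mat)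
                  \<Rightarrow> (nat \<Rightarrow> real) \<Rightarrow> (nat \<Rightarrow> complex mat) \<Rightarrow> complex" where
  "objective K Nr Nt Nd Hs c Fn \<omega> F = (\<Sum>k<K. complex_of_real (\<omega> k) * gk K Nr Nt Nd Hs c Fn k F)"

text \<open>blkdiag(w_1 A_1^H, ..., w_K A_K^H) and blkdiag(w_1 B_1^H, ..., w_K B_K^H).\<close>

definition Atilde :: "nat \<Rightarrow> nat \<Rightarrow> nat \<Rightarrow> (nat \<Rightarrow> complex mat) \<Rightarrow> real \<Rightarrow> (nat \<Rightarrow> complex mat)
                  \<Rightarrow> (nat \<Rightarrow> real) \<Rightarrow> complex mat" where
  "Atilde K Nr Nt Hs c Fn \<omega> = mat (K*Nr) (K*Nr) (\<lambda>(i,j).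
     if i div Nr = j div Nr
     then complex_of_real (\<omega> (i div Nr)) * ctr (Ahat K Nr Nt Hs c Fn (i div Nr)) $$ (i mod Nr, j mod Nr)
     else 0)"

definition Btilde :: "nat \<Rightarrow> nat \<Rightarrow> nat \<Rightarrow> nat \<Rightarrow> (nat \<Rightarrow> complex mat) \<Rightarrow> real \<Rightarrow> (nat \<Rightarrow> complex mat)
                  \<Rightarrow> (nat \<Rightarrow> real) \<Rightarrow> complex mat" where
  "Btilde K Nr Nt Nd Hs c Fn \<omega> = mat (K*Nr) (K*Nd) (\<lambda>(i,j).
     if i div Nr = j div Nd
     then complex_of_real (\<omega> (i div Nr)) * ctr (Bhat K Nr Nt Hs c Fn (i div Nr)) $$ (i mod Nr, j mod Nd)
     else 0)"

definition mu :: "nat \<Rightarrow> nat \<Rightarrow> nat \<Rightarrow> (nat \<Rightarrow> complex mat) \<Rightarrow> real \<Rightarrow> (nat \<Rightarrow> complex mat)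
                  \<Rightarrow> (nat \<Rightarrow> real) \<Rightarrow> complex" where
  "mu K Nr Nt Hs c Fn \<omega> = complex_of_real c *
     (\<Sum>k<K. complex_of_real (\<omega> k) * mtrace (ctr (Ahat K Nr Nt Hs c Fn k)))"

definition Fsol :: "nat \<Rightarrow> nat \<Rightarrow> nat \<Rightarrow> nat \<Rightarrow> (nat \<Rightarrow> complex mat) \<Rightarrow> real \<Rightarrow> (nat \<Rightarrow> complex mat)
                  \<Rightarrow> (nat \<Rightarrow> real) \<Rightarrow> complex mat" where
  "Fsol K Nr Nt Nd Hs c Fn \<omega> =
     minv (mu K Nr Nt Hs c Fn \<omega> \<cdot>\<^sub>m 1\<^sub>m (K*Nr) + Atilde K Nr Nt Hs c Fn \<omega> * Hbar K Nr Nt Hs)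
     * Btilde K Nr Nt Nd Hs c Fn \<omega>"

definition colblock :: "nat \<Rightarrow> nat \<Rightarrow> complex mat \<Rightarrow> nat \<Rightarrow> complex mat" where
  "colblock Nd R F k = mat R Nd (\<lambda>(i,j). F $$ (i, k*Nd + j))"

end

(* Up to a constant, the objective splits into one concave quadratic per user,
   2 Re Tr (E_k^H G F_k) - Tr (F_k^H M F_k), where G is the Gram matrix H H^H, E_k is the k-th
   column block of B~, and M = G A~ G + mu G = G (mu I + A~ G).  Since each A_k is positive
   semidefinite, so is M, and completing the square shows that every solution of M F_k = G E_k is
   a maximizer; (mu I + A~ G)^-1 E_k is one.  The matrix mu I + A~ G is invertible if mu > 0.
   If mu = 0, then all traces Tr A_k vanish, which forces X_k = 0, A_k = 0 and B_k = 0, so that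
   the objective is constant and the (junk) value of the inverse does not matter. *)

theory Submission
  imports Defs
begin

section \<open>Conjugate transpose and trace\<close>

lemma dim_ctr [simp]: "dim_row (ctr A) = dim_col A" "dim_col (ctr A) = dim_row A"
  by (simp_all add: ctr_def)

lemma ctr_carrier [simp]: "A \<in> carrier_mat n m \<Longrightarrow> ctr A \<in> carrier_mat m n"
  by (auto simp: ctr_def)

lemma ctr_index [simp]:
  "i < dim_col A \<Longrightarrow> j < dim_row A \<Longrightarrow> ctr A $$ (i,j) = cnj (A $$ (j,i))"
  by (simp add: ctr_def)

lemma ctr_ctr [simp]: "ctr (ctr A) = A"
  by (rule eq_matI) simp_all

lemma ctr_one [simp]: "ctr (1\<^sub>m n) = 1\<^sub>m n"
  by (rule eq_matI) auto

lemma ctr_zero [simp]: "ctr (0\<^sub>m n m) = 0\<^sub>m m n"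
  by (rule eq_matI) auto

lemma ctr_add:
  "dim_row A = dim_row B \<Longrightarrow> dim_col A = dim_col B \<Longrightarrow> ctr (A + B) = ctr A + ctr B"
  by (rule eq_matI) simp_all

lemma ctr_minus:
  "dim_row A = dim_row B \<Longrightarrow> dim_col A = dim_col B \<Longrightarrow> ctr (A - B) = ctr A - ctr B"
  by (rule eq_matI) simp_all

lemma ctr_smult: "ctr (a \<cdot>\<^sub>m A) = cnj a \<cdot>\<^sub>m ctr A"
  by (rule eq_matI) simp_all

text \<open>The entry is spelled out as a finite sum instead of a scalar product of a row and a
  column, so that the double and triple sums behind traces can be swapped. Uses of it switch off
  \<open>index_mult_mat(1)\<close>, which would unfold the same entry differently.\<close>

lemma mult_mat_entry:
  assumes "A \<in> carrier_mat n m" "B \<in> carrier_mat m p" "i < n" "j < p"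
  shows "(A * B) $$ (i,j) = (\<Sum>k<m. A $$ (i,k) * B $$ (k,j))"
  using assms by (auto simp: scalar_prod_def lessThan_atLeast0)

lemma ctr_mult:
  assumes "dim_col A = dim_row B"
  shows "ctr (A * B) = ctr B * ctr A"
proof (rule eq_matI)
  fix i j assume "i < dim_row (ctr B * ctr A)" "j < dim_col (ctr B * ctr A)"
  then show "ctr (A * B) $$ (i, j) = (ctr B * ctr A) $$ (i, j)"
    using assms by (simp add: scalar_prod_def mult.commute)
qed simp_all

text \<open>This law and the ones collected in \<open>mat_ring_dim\<close> replace carrier premises
  by equations between dimensions. The intermediate dimensions then need no instantiation, and the
  laws work as conditional rewrite rules.\<close>

lemma mult_assoc_dim:
  fixes A B C :: "'a :: semiring_0 mat"
  shows "dim_col A = dim_row B \<Longrightarrow> dim_col B = dim_row C \<Longrightarrow> A * B * C = A * (B * C)"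
  by (rule assoc_mult_mat[of _ "dim_row A" "dim_col A" _ "dim_col B" _ "dim_col C"]) auto

lemma mult_add_distrib_dim:
  fixes A B C :: "'a :: semiring_0 mat"
  shows "dim_col A = dim_row B \<Longrightarrow> dim_row B = dim_row C \<Longrightarrow> dim_col B = dim_col C
    \<Longrightarrow> A * (B + C) = A * B + A * C"
  by (rule mult_add_distrib_mat[of _ "dim_row A" "dim_col A" _ "dim_col B"]) auto

lemma add_mult_distrib_dim:
  fixes A B C :: "'a :: semiring_0 mat"
  shows "dim_col A = dim_row C \<Longrightarrow> dim_row A = dim_row B \<Longrightarrow> dim_col A = dim_col B
    \<Longrightarrow> (A + B) * C = A * C + B * C"
  by (rule add_mult_distrib_mat[of _ "dim_row A" "dim_col A" _ _ "dim_col C"]) auto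

lemma mult_minus_distrib_dim:
  fixes A B C :: "'a :: ring mat"
  shows "dim_col A = dim_row B \<Longrightarrow> dim_row B = dim_row C \<Longrightarrow> dim_col B = dim_col C
    \<Longrightarrow> A * (B - C) = A * B - A * C"
  by (rule mult_minus_distrib_mat[of _ "dim_row A" "dim_col A" _ "dim_col B"]) auto

lemma minus_mult_distrib_dim:
  fixes A B C :: "'a :: ring mat"
  shows "dim_col A = dim_row C \<Longrightarrow> dim_row A = dim_row B \<Longrightarrow> dim_col A = dim_col B
    \<Longrightarrow> (A - B) * C = A * C - B * C"
  by (rule minus_mult_distrib_mat[of _ "dim_row A" "dim_col A" _ _ "dim_col C"]) auto

lemma mult_smult_dim:
  fixes A B :: "'a :: comm_semiring_0 mat"
  shows "dim_col A = dim_row B \<Longrightarrow> A * (a \<cdot>\<^sub>m B) = a \<cdot>\<^sub>m (A * B)"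
  by (rule mult_smult_distrib[of _ "dim_row A" "dim_col A" _ "dim_col B"]) auto

lemma smult_mult_dim:
  fixes A B :: "'a :: comm_semiring_0 mat"
  shows "dim_col A = dim_row B \<Longrightarrow> (a \<cdot>\<^sub>m A) * B = a \<cdot>\<^sub>m (A * B)"
  by (rule mult_smult_assoc_mat[of _ "dim_row A" "dim_col A" _ "dim_col B"]) auto

lemmas mat_ring_dim = mult_assoc_dim mult_add_distrib_dim add_mult_distrib_dim
  mult_minus_distrib_dim minus_mult_distrib_dim mult_smult_dim smult_mult_dim

section \<open>Linearity and cyclicity of the trace, and trace forms\<close>

lemma mtrace_add: "dim_row A = dim_row B \<Longrightarrow> dim_col B = dim_row B
    \<Longrightarrow> mtrace (A + B) = mtrace A + mtrace B"
  by (simp add: mtrace_def sum.distrib)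

lemma mtrace_minus: "dim_row A = dim_row B \<Longrightarrow> dim_col B = dim_row B
    \<Longrightarrow> mtrace (A - B) = mtrace A - mtrace B"
  by (simp add: mtrace_def sum_subtractf)

lemma mtrace_smult: "dim_col A = dim_row A \<Longrightarrow> mtrace (a \<cdot>\<^sub>m A) = a * mtrace A"
  by (simp add: mtrace_def sum_distrib_left)

lemma mtrace_zero [simp]: "mtrace (0\<^sub>m n n) = 0"
  by (simp add: mtrace_def)

lemma mtrace_ctr: "dim_col A = dim_row A \<Longrightarrow> mtrace (ctr A) = cnj (mtrace A)"
  by (simp add: mtrace_def)

lemma mtrace_mult_commute:
  assumes "A \<in> carrier_mat n m" "B \<in> carrier_mat m n"
  shows "mtrace (A * B) = mtrace (B * A)"
proof -
  have "mtrace (A * B) = (\<Sum>i<n. \<Sum>k<m. A $$ (i,k) * B $$ (k,i))"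
    using assms by (simp add: mtrace_def mult_mat_entry[OF assms] del: index_mult_mat(1))
  also have "\<dots> = (\<Sum>k<m. \<Sum>i<n. B $$ (k,i) * A $$ (i,k))"
    by (subst sum.swap) (simp add: mult.commute)
  also have "\<dots> = mtrace (B * A)"
    using assms by (simp add: mtrace_def mult_mat_entry[OF assms(2,1)] del: index_mult_mat(1))
  finally show ?thesis .
qed

lemma mtrace_ctr_mult:
  assumes "A \<in> carrier_mat n m" "B \<in> carrier_mat n m"
  shows "mtrace (ctr A * B) = (\<Sum>c<m. \<Sum>i<n. cnj (A $$ (i,c)) * B $$ (i,c))"
  using assms
  by (simp add: mtrace_def mult_mat_entry[OF ctr_carrier[OF assms(1)] assms(2)] del: index_mult_mat(1))

text \<open>Every positivity argument tests a matrix against such a trace. The entrywise form serves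
  the two constructions given by entries, \<open>msum\<close> and \<open>blkdiag\<close>.\<close>

lemma mtrace_quadratic_form:
  assumes "A \<in> carrier_mat n n" "V \<in> carrier_mat n m"
  shows "mtrace (ctr V * A * V) = (\<Sum>c<m. \<Sum>i<n. \<Sum>j<n. cnj (V $$ (i,c)) * A $$ (i,j) * V $$ (j,c))"
proof -
  have "mtrace (ctr V * A * V) = mtrace (ctr V * (A * V))"
    using assms by (simp add: mult_assoc_dim)
  also have "\<dots> = (\<Sum>c<m. \<Sum>i<n. cnj (V $$ (i,c)) * (A * V) $$ (i,c))"
    using assms by (intro mtrace_ctr_mult) auto
  also have "\<dots> = (\<Sum>c<m. \<Sum>i<n. cnj (V $$ (i,c)) * (\<Sum>j<n. A $$ (i,j) * V $$ (j,c)))"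
    by (intro sum.cong refl) (simp add: mult_mat_entry[OF assms] del: index_mult_mat(1))
  finally show ?thesis by (simp add: sum_distrib_left mult.assoc)
qed

text \<open>The right-hand side is the squared Frobenius norm of V.\<close>

lemma mtrace_ctr_mult_self:
  "mtrace (ctr V * V) = of_real (\<Sum>c<dim_col V. \<Sum>i<dim_row V. (cmod (V $$ (i,c)))\<^sup>2)"
proof -
  have V: "V \<in> carrier_mat (dim_row V) (dim_col V)" by simp
  show ?thesis
    unfolding mtrace_ctr_mult[OF V V] of_real_sum complex_norm_square
    by (simp only: mult.commute)
qed

lemma mtrace_ctr_mult_self_nonneg: "Re (mtrace (ctr V * V)) \<ge> 0"
  by (simp add: mtrace_ctr_mult_self sum_nonneg del: of_real_sum)

text \<open>Definiteness of the Frobenius norm. The premise is an inequality because it is obtained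
  by dropping a nonnegative summand.\<close>

lemma mtrace_ctr_mult_self_eq_0:
  assumes "Re (mtrace (ctr V * V)) \<le> 0"
  shows "V = 0\<^sub>m (dim_row V) (dim_col V)"
proof -
  have "(\<Sum>c<dim_col V. \<Sum>i<dim_row V. (cmod (V $$ (i,c)))\<^sup>2) = 0"
    using assms mtrace_ctr_mult_self_nonneg[of V] by (simp add: mtrace_ctr_mult_self del: of_real_sum)
  then have "\<forall>c<dim_col V. \<forall>i<dim_row V. V $$ (i,c) = 0"
    by (simp add: sum_nonneg_eq_0_iff sum_nonneg)
  then show ?thesis by (intro eq_matI) auto
qed

section \<open>Matrix inverses\<close>

lemma minv:
  assumes "A \<in> carrier_mat n n" "invertible_mat A"
  shows minv_carrier: "minv A \<in> carrier_mat n n"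
    and mult_minv: "A * minv A = 1\<^sub>m n"
    and minv_mult: "minv A * A = 1\<^sub>m n"
proof -
  have "\<exists>B. inverts_mat A B \<and> inverts_mat B A"
    using assms(2) by (auto simp: invertible_mat_def)
  from someI_ex[OF this] have *: "inverts_mat A (minv A) \<and> inverts_mat (minv A) A"
    using assms(2) by (simp add: minv_def)
  then have 1: "A * minv A = 1\<^sub>m n" and 2: "minv A * A = 1\<^sub>m (dim_row (minv A))"
    using assms(1) by (auto simp: inverts_mat_def)
  \<comment> \<open>The choice operator does not fix the shape of \<open>minv A\<close>. Its column
    count comes from the product with A on the left, its row count from the product with A on the
    right.\<close>
  from 1 have "dim_col (minv A) = n" by (metis index_mult_mat(3) index_one_mat(3))
  moreover from 2 have "dim_row (minv A) = n"
    using assms(1) by (metis carrier_matD(2) index_mult_mat(3) index_one_mat(3))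
  ultimately show "minv A \<in> carrier_mat n n" "A * minv A = 1\<^sub>m n" "minv A * A = 1\<^sub>m n"
    using 1 2 by auto
qed

text \<open>A zero determinant would give a nonzero kernel vector. The kernel is phrased with
  one-column matrices so that it can be examined with \<open>ctr\<close> and
  \<open>mtrace\<close>.\<close>

lemma invertible_mat_if_kernel_trivial:
  fixes A :: "complex mat"
  assumes A: "A \<in> carrier_mat n n"
    and ker: "\<And>V. V \<in> carrier_mat n 1 \<Longrightarrow> A * V = 0\<^sub>m n 1 \<Longrightarrow> V = 0\<^sub>m n 1"
  shows "invertible_mat A"
proof -
  have "det A \<noteq> 0"
  proof
    assume "det A = 0"
    then obtain v where v: "v \<in> carrier_vec n" "v \<noteq> 0\<^sub>v n" "A *\<^sub>v v = 0\<^sub>v n"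
      using det_0_iff_vec_prod_zero[OF A] by auto
    define V where "V = mat_of_cols n [v]"
    have V: "V \<in> carrier_mat n 1" by (simp add: V_def carrier_matI)
    have colV: "col V 0 = v" using v by (simp add: V_def)
    have "A * V = 0\<^sub>m n 1"
    proof (rule eq_matI)
      fix i j assume "i < dim_row (0\<^sub>m n 1 :: complex mat)" "j < dim_col (0\<^sub>m n 1 :: complex mat)"
      then have ij: "i < n" "j = 0" by auto
      have "(A * V) $$ (i,0) = (A *\<^sub>v v) $ i" using A V ij colV by simp
      with v ij show "(A * V) $$ (i,j) = 0\<^sub>m n 1 $$ (i,j)" by simp
    qed (use A V in auto)
    from ker[OF V this] have "col V 0 = 0\<^sub>v n" by simp
    with colV v show False by simp
  qed
  from det_non_zero_imp_unit[OF A this, of undefined]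
  obtain B where "B \<in> carrier_mat n n" "A * B = 1\<^sub>m n" "B * A = 1\<^sub>m n"
    by (auto simp: Units_def ring_mat_def)
  with A show ?thesis by (auto simp: invertible_mat_def inverts_mat_def)
qed

section \<open>Positive semidefinite matrices\<close>

text \<open>The test matrix V may have any number of columns, which amounts to testing each column
  separately. Precoder blocks can thus be inserted for V directly. The real part is the whole trace,
  since A is Hermitian.\<close>

definition psd :: "nat \<Rightarrow> complex mat \<Rightarrow> bool" where
  "psd n A \<longleftrightarrow> A \<in> carrier_mat n n \<and> ctr A = A \<and>
     (\<forall>m V. V \<in> carrier_mat n m \<longrightarrow> 0 \<le> Re (mtrace (ctr V * A * V)))"

lemma psdD:
  assumes "psd n A"
  shows psd_carrier: "A \<in> carrier_mat n n" and psd_ctr: "ctr A = A"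
    and psd_nonneg: "V \<in> carrier_mat n m \<Longrightarrow> 0 \<le> Re (mtrace (ctr V * A * V))"
  using assms by (auto simp: psd_def)

lemma psd_one: "psd n (1\<^sub>m n)"
  by (auto simp: psd_def mtrace_ctr_mult_self_nonneg)

lemma psd_add:
  assumes "psd n A" "psd n B"
  shows "psd n (A + B)"
  unfolding psd_def
proof (intro conjI allI impI)
  show "ctr (A + B) = A + B" "A + B \<in> carrier_mat n n"
    using psdD(1,2)[OF assms(1)] psdD(1,2)[OF assms(2)] by (auto simp: ctr_add)
  fix m and V :: "complex mat" assume V: "V \<in> carrier_mat n m"
  have "mtrace (ctr V * (A + B) * V) = mtrace (ctr V * A * V) + mtrace (ctr V * B * V)"
    using V psd_carrier[OF assms(1)] psd_carrier[OF assms(2)] by (simp add: mat_ring_dim mtrace_add)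
  then show "0 \<le> Re (mtrace (ctr V * (A + B) * V))"
    using psd_nonneg[OF assms(1) V] psd_nonneg[OF assms(2) V] by simp
qed

lemma psd_smult:
  assumes "psd n A" "r \<ge> 0"
  shows "psd n (complex_of_real r \<cdot>\<^sub>m A)"
  unfolding psd_def
proof (intro conjI allI impI)
  show "ctr (complex_of_real r \<cdot>\<^sub>m A) = complex_of_real r \<cdot>\<^sub>m A" "complex_of_real r \<cdot>\<^sub>m A \<in> carrier_mat n n"
    using psdD(1,2)[OF assms(1)] by (auto simp: ctr_smult)
  fix m and V :: "complex mat" assume V: "V \<in> carrier_mat n m"
  have "mtrace (ctr V * (complex_of_real r \<cdot>\<^sub>m A) * V) = r * mtrace (ctr V * A * V)"
    using V psd_carrier[OF assms(1)] by (simp add: mat_ring_dim mtrace_smult)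
  then show "0 \<le> Re (mtrace (ctr V * (complex_of_real r \<cdot>\<^sub>m A) * V))"
    using psd_nonneg[OF assms(1) V] assms(2) by simp
qed

lemma psd_congruence:
  assumes "psd n A" "W \<in> carrier_mat n m"
  shows "psd m (ctr W * A * W)"
  unfolding psd_def
proof (intro conjI allI impI)
  show "ctr W * A * W \<in> carrier_mat m m" "ctr (ctr W * A * W) = ctr W * A * W"
    using psdD(1,2)[OF assms(1)] assms(2) by (auto simp: ctr_mult mult_assoc_dim)
  fix p and V :: "complex mat" assume V: "V \<in> carrier_mat m p"
  have "ctr V * (ctr W * A * W) * V = ctr (W * V) * A * (W * V)"
    using V psd_carrier[OF assms(1)] assms(2) by (simp add: ctr_mult mult_assoc_dim)
  then show "0 \<le> Re (mtrace (ctr V * (ctr W * A * W) * V))"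
    using psd_nonneg[OF assms(1), of "W * V" p] V assms(2) by simp
qed

lemma psd_ctr_mult_self:
  assumes "W \<in> carrier_mat n m"
  shows "psd m (ctr W * W)"
  using psd_congruence[OF psd_one assms] assms by simp

lemma psd_mtrace_nonneg:
  assumes "psd n A"
  shows "0 \<le> Re (mtrace A)"
  using psd_nonneg[OF assms, of "1\<^sub>m n" n] psd_carrier[OF assms] by simp

lemma mtrace_hermitian:
  assumes "ctr A = A"
  shows "mtrace A = of_real (Re (mtrace A))"
proof -
  have "dim_col A = dim_row A" using assms by (metis dim_ctr(1))
  from mtrace_ctr[OF this] assms have "mtrace A = cnj (mtrace A)" by simp
  then show ?thesis by (metis Reals_cnj_iff of_real_Re)
qed

text \<open>The inverse of a Hermitian A is congruent to A itself: A^-1 = A^-1 A (A^-1)^H.\<close>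

lemma psd_minv:
  assumes "psd n A" "invertible_mat A"
  shows "psd n (minv A)"
proof -
  note A = psdD(1,2)[OF assms(1)]
  note inv = minv[OF A(1) assms(2)]
  have "minv A * (A * ctr (minv A)) = minv A"
  proof -
    have "A * ctr (minv A) = ctr (minv A * A)" 
      using A(2) A(1) inv(1) by (subst ctr_mult) auto
    then show ?thesis using inv by simp
  qed
  moreover have "minv A * (A * ctr (minv A)) = ctr (ctr (minv A)) * A * ctr (minv A)"
    using A(1) inv(1) by (simp add: mult_assoc_dim)
  ultimately show ?thesis using psd_congruence[OF assms(1) ctr_carrier[OF inv(1)]] by simp
qed

text \<open>For \<open>Z = X X\<^sup>H + Y\<close> one has
  \<open>Z (Y\<^sup>-\<^sup>1 - Z\<^sup>-\<^sup>1) Z = Z Y\<^sup>-\<^sup>1 Z - Z = X X\<^sup>H + X X\<^sup>H Y\<^sup>-\<^sup>1 X X\<^sup>H\<close>,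
  which is visibly positive semidefinite.\<close>

lemma minv_diff_factorization:
  assumes Y: "psd n Y" "invertible_mat Y" and X: "X \<in> carrier_mat n m"
  defines "Z \<equiv> X * ctr X + Y"
  defines "U \<equiv> ctr X * minv Z"
  shows "invertible_mat Z"
    and "minv Y - minv Z = ctr U * U + ctr (X * U) * minv Y * (X * U)"
proof -
  note Yc = psdD(1,2)[OF Y(1)]
  note Yi = minv[OF Yc(1) Y(2)]
  have Zc: "Z \<in> carrier_mat n n" using X Yc by (simp add: Z_def)
  show inv: "invertible_mat Z"
  proof (rule invertible_mat_if_kernel_trivial[OF Zc])
    fix V assume V: "V \<in> carrier_mat n 1" and ZV: "Z * V = 0\<^sub>m n 1"
    \<comment> \<open>Testing Z V = 0 against V gives |X^H V|^2 + Tr (V^H Y V) = 0 with both terms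
      nonnegative. Hence X^H V = 0, then Y V = 0, and invertibility of Y yields V = 0.\<close>
    have "ctr V * (Z * V) = ctr (ctr X * V) * (ctr X * V) + ctr V * Y * V"
      using V X Yc by (simp add: Z_def mat_ring_dim ctr_mult)
    moreover have "ctr V * (Z * V) = 0\<^sub>m 1 1" using V ZV by simp
    ultimately have "mtrace (ctr (ctr X * V) * (ctr X * V) + ctr V * Y * V) = 0"
      by (metis mtrace_zero)
    then have "mtrace (ctr (ctr X * V) * (ctr X * V)) + mtrace (ctr V * Y * V) = 0"
      using V X Yc by (simp add: mtrace_add)
    then have "Re (mtrace (ctr (ctr X * V) * (ctr X * V))) \<le> 0"
      using psd_nonneg[OF Y(1) V] by (smt (verit) plus_complex.sel(1) zero_complex.sel(1))
    from mtrace_ctr_mult_self_eq_0[OF this] have XV: "ctr X * V = 0\<^sub>m m 1" using X V by simp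
    have "Z * V = X * (ctr X * V) + Y * V"
      using V X Yc by (simp add: Z_def mat_ring_dim)
    then have "Y * V = 0\<^sub>m n 1" using XV X ZV Yc V by simp
    then have "minv Y * (Y * V) = 0\<^sub>m n 1" using Yi by simp
    moreover have "minv Y * (Y * V) = minv Y * Y * V" using Yi(1) Yc(1) V by (simp add: mult_assoc_dim)
    ultimately show "V = 0\<^sub>m n 1" using Yi V by simp
  qed
  note Zi = minv[OF Zc inv]
  have "psd n (X * ctr X)" using psd_ctr_mult_self[OF ctr_carrier[OF X]] by simp
  then have Zpsd: "psd n Z" unfolding Z_def using Y(1) by (rule psd_add)
  have cZi: "ctr (minv Z) = minv Z" using psd_ctr[OF psd_minv[OF Zpsd inv]] .
  define P where "P = X * ctr X"
  have P: "P \<in> carrier_mat n n" using X by (simp add: P_def)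
  have ZP: "Z = P + Y" by (simp add: P_def Z_def)
  have 1: "(minv Y - minv Z) * Z = minv Y * P"
  proof -
    have "(minv Y - minv Z) * Z = minv Y * Z - minv Z * Z"
      using Yi Zi Zc by (simp add: minus_mult_distrib_dim)
    also have "\<dots> = minv Y * P + 1\<^sub>m n - 1\<^sub>m n"
      using Yi Zi Yc P by (simp add: ZP mult_add_distrib_dim)
    also have "\<dots> = minv Y * P" using Yi P by (intro eq_matI) auto
    finally show ?thesis .
  qed
  have 2: "Z * (minv Y * P) = P + P * (minv Y * P)"
  proof -
    have "Z * (minv Y * P) = P * (minv Y * P) + (Y * minv Y) * P"
      using Yi(1) Yc(1) P by (simp add: ZP add_mult_distrib_dim mult_assoc_dim)
    also have "\<dots> = P + P * (minv Y * P)"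
      using Yi Yc P comm_add_mat[of P n n "P * (minv Y * P)"] by simp
    finally show ?thesis .
  qed
  \<comment> \<open>Inserting the identity as Z^-1 Z on the left and Z Z^-1 on the right exposes Z
    (Y^-1 - Z^-1) Z, which facts 1 and 2 evaluate. The outer factors Z^-1 are Hermitian and are
    absorbed into U = X^H Z^-1.\<close>
  have "minv Y - minv Z = (minv Z * Z) * ((minv Y - minv Z) * (Z * minv Z))"
    using Yi(1) Zi by (simp add: minus_carrier_mat[of _ n n])
  also have "\<dots> = minv Z * (Z * ((minv Y - minv Z) * Z)) * minv Z"
    using Yi(1) Zi(1) Zc by (simp add: mult_assoc_dim)
  also have "\<dots> = minv Z * (P + P * (minv Y * P)) * minv Z"
    by (simp add: 1 2)
  also have "\<dots> = ctr U * U + ctr (X * U) * minv Y * (X * U)"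
    using Yi(1) Zi(1) X by (simp add: U_def P_def mat_ring_dim ctr_mult cZi)
  finally show "minv Y - minv Z = ctr U * U + ctr (X * U) * minv Y * (X * U)" .
qed

text \<open>Both summands of the factorization are positive semidefinite. If their total trace is
  not positive, then U = X^H Z^-1 has Frobenius norm 0, so X^H = U Z = 0. The second claim handles
  the degenerate case \<mu> = 0.\<close>

lemma psd_minv_diff:
  assumes Y: "psd n Y" "invertible_mat Y" and X: "X \<in> carrier_mat n m"
  shows "psd n (minv Y - minv (X * ctr X + Y))"
    and "Re (mtrace (minv Y - minv (X * ctr X + Y))) \<le> 0 \<Longrightarrow> X = 0\<^sub>m n m"
proof -
  define Z where "Z = X * ctr X + Y"
  define U where "U = ctr X * minv Z"
  have Zc: "Z \<in> carrier_mat n n" using X psd_carrier[OF Y(1)] by (simp add: Z_def)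
  note fact = minv_diff_factorization[OF Y X, folded Z_def, folded U_def]
  note Zi = minv[OF Zc fact(1)]
  have Uc: "U \<in> carrier_mat m n" using mult_carrier_mat[OF ctr_carrier[OF X] Zi(1)] by (simp add: U_def)
  have p1: "psd n (ctr U * U)" by (rule psd_ctr_mult_self[OF Uc])
  have p2: "psd n (ctr (X * U) * minv Y * (X * U))"
    using psd_congruence[OF psd_minv[OF Y], of "X * U" n] X Uc by simp
  show "psd n (minv Y - minv (X * ctr X + Y))"
    using psd_add[OF p1 p2] by (simp add: Z_def[symmetric] fact(2))
  assume "Re (mtrace (minv Y - minv (X * ctr X + Y))) \<le> 0"
  then have "Re (mtrace (ctr U * U) + mtrace (ctr (X * U) * minv Y * (X * U))) \<le> 0"
    using Uc X by (simp add: Z_def[symmetric] fact(2) mtrace_add)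
  then have "Re (mtrace (ctr U * U)) \<le> 0" using psd_mtrace_nonneg[OF p2] by simp
  from mtrace_ctr_mult_self_eq_0[OF this] have U0: "U = 0\<^sub>m m n" using Uc by simp
  have "ctr X = ctr X * (minv Z * Z)" using Zi X by simp
  also have "\<dots> = U * Z" using Zi Zc X by (simp add: U_def mult_assoc_dim)
  finally have "ctr X = 0\<^sub>m m n" using U0 Zc by simp
  then have "ctr (ctr X) = 0\<^sub>m n m" by simp
  then show "X = 0\<^sub>m n m" by simp
qed

text \<open>Completing the square: the gap between the two sides is Tr ((G - F)^H M (G - F)), which
  is nonnegative.\<close>

lemma psd_quadratic_maximum:
  assumes M: "psd n M" and F: "F \<in> carrier_mat n d" "G \<in> carrier_mat n d"
  shows "2 * Re (mtrace (ctr G * M * F)) - Re (mtrace (ctr F * M * F))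
       \<le> 2 * Re (mtrace (ctr G * M * G)) - Re (mtrace (ctr G * M * G))"
proof -
  note Mc = psdD(1,2)[OF M]
  have "mtrace (ctr F * M * G) = mtrace (ctr (ctr G * M * F))"
    using Mc F by (simp add: ctr_mult mult_assoc_dim)
  then have sym: "Re (mtrace (ctr F * M * G)) = Re (mtrace (ctr G * M * F))"
    using F by (simp add: mtrace_ctr)
  have "0 \<le> Re (mtrace (ctr (G - F) * M * (G - F)))"
    using F by (intro psd_nonneg[OF M]) auto
  also have "mtrace (ctr (G - F) * M * (G - F)) = mtrace (ctr G * M * G) - mtrace (ctr F * M * G)
      - (mtrace (ctr G * M * F) - mtrace (ctr F * M * F))"
    using F Mc by (simp add: ctr_minus mat_ring_dim mtrace_minus)
  finally show ?thesis using sym by simp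
qed

lemma psd_msum:
  assumes "\<And>k. k \<in> S \<Longrightarrow> psd n (f k)"
  shows "psd n (msum n n f S)"
  unfolding psd_def
proof (intro conjI allI impI)
  show c: "msum n n f S \<in> carrier_mat n n" by (simp add: msum_def)
  have herm: "cnj (f k $$ (j,i)) = f k $$ (i,j)" if "k \<in> S" "i < n" "j < n" for k i j
    using ctr_index[of i "f k" j] psdD(1,2)[OF assms[OF that(1)]] that by simp
  show "ctr (msum n n f S) = msum n n f S"
  proof (rule eq_matI)
    fix i j assume "i < dim_row (msum n n f S)" "j < dim_col (msum n n f S)"
    then have ij: "i < n" "j < n" by (auto simp: msum_def)
    have "(\<Sum>k\<in>S. cnj (f k $$ (j,i))) = (\<Sum>k\<in>S. f k $$ (i,j))"
      by (intro sum.cong refl herm ij)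
    with ij show "ctr (msum n n f S) $$ (i,j) = msum n n f S $$ (i,j)" by (simp add: msum_def)
  qed (simp_all add: msum_def)
  fix m and V :: "complex mat" assume V: "V \<in> carrier_mat n m"
  have "mtrace (ctr V * msum n n f S * V)
      = (\<Sum>c<m. \<Sum>i<n. \<Sum>j<n. \<Sum>k\<in>S. cnj (V $$ (i,c)) * f k $$ (i,j) * V $$ (j,c))"
    unfolding mtrace_quadratic_form[OF c V]
    by (intro sum.cong refl) (simp add: msum_def sum_distrib_left sum_distrib_right)
  also have "\<dots> = (\<Sum>k\<in>S. \<Sum>c<m. \<Sum>i<n. \<Sum>j<n. cnj (V $$ (i,c)) * f k $$ (i,j) * V $$ (j,c))"
    \<comment> \<open>Fixing the inner index set as S makes the rewriting carry the sum over S
      outwards one level at a time.\<close>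
    by (simp only: sum.swap[of _ S])
  also have "\<dots> = (\<Sum>k\<in>S. mtrace (ctr V * f k * V))"
    by (intro sum.cong refl mtrace_quadratic_form[symmetric, OF _ V] psd_carrier assms)
  finally show "0 \<le> Re (mtrace (ctr V * msum n n f S * V))"
    using psd_nonneg[OF assms V] by (simp add: sum_nonneg)
qed

text \<open>The product A G with G = H H^H need not be Hermitian, so a kernel element V is tested
  against G V instead of V. This gives m |H^H V|^2 + Tr ((G V)^H A (G V)) = 0, hence H^H V = 0 and G
  V = 0, and what remains of the kernel equation is m V = 0.\<close>

lemma invertible_shifted_psd_product:
  assumes A: "psd n A" and H: "H \<in> carrier_mat n p" and m: "m > 0"
  shows "invertible_mat (complex_of_real m \<cdot>\<^sub>m 1\<^sub>m n + A * (H * ctr H))"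
proof (rule invertible_mat_if_kernel_trivial)
  note Ac = psdD(1,2)[OF A]
  define G where "G = H * ctr H"
  have G: "G \<in> carrier_mat n n" "ctr G = G" using H by (auto simp: G_def ctr_mult)
  let ?S = "complex_of_real m \<cdot>\<^sub>m 1\<^sub>m n + A * (H * ctr H)"
  show "?S \<in> carrier_mat n n" using Ac H by auto
  fix V assume V: "V \<in> carrier_mat n 1" and SV: "?S * V = 0\<^sub>m n 1"
  have SV': "?S * V = complex_of_real m \<cdot>\<^sub>m V + A * (G * V)"
    using Ac G(1) V unfolding G_def[symmetric] by (simp add: mat_ring_dim)
  define T where "T = ctr H * V"
  have T: "T \<in> carrier_mat p 1" unfolding T_def by (rule mult_carrier_mat[OF ctr_carrier[OF H] V])
  have "ctr (G * V) * (?S * V) = complex_of_real m \<cdot>\<^sub>m (ctr T * T) + ctr (G * V) * A * (G * V)"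
    unfolding SV' using Ac G(1) V H by (simp add: mat_ring_dim ctr_mult T_def G_def)
  moreover have "ctr (G * V) * (?S * V) = 0\<^sub>m 1 1"
    unfolding SV using G(1) V by (intro right_mult_zero_mat) auto
  ultimately have "mtrace (complex_of_real m \<cdot>\<^sub>m (ctr T * T) + ctr (G * V) * A * (G * V)) = 0"
    by (metis mtrace_zero)
  then have "m * mtrace (ctr T * T) + mtrace (ctr (G * V) * A * (G * V)) = 0"
    using T V G(1) by (simp add: mtrace_add mtrace_smult)
  then have "m * Re (mtrace (ctr T * T)) + Re (mtrace (ctr (G * V) * A * (G * V))) = 0"
    by (drule_tac arg_cong[where f = Re]) simp
  moreover have "0 \<le> Re (mtrace (ctr (G * V) * A * (G * V)))"
    using G(1) V by (intro psd_nonneg[OF A, of _ 1]) auto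
  ultimately have "Re (mtrace (ctr T * T)) \<le> 0"
    using m by (smt (verit) mult_pos_pos)
  from mtrace_ctr_mult_self_eq_0[OF this] have T0: "T = 0\<^sub>m p 1" using T by simp
  have "G * V = H * T" using H V by (simp add: G_def T_def mult_assoc_dim)
  then have "G * V = 0\<^sub>m n 1" using T0 H by simp
  then have "complex_of_real m \<cdot>\<^sub>m V = 0\<^sub>m n 1" using SV SV' Ac V by simp
  then have "\<And>i. i < n \<Longrightarrow> complex_of_real m * V $$ (i,0) = 0"
    using V by (metis carrier_matD index_smult_mat(1) index_zero_mat(1) less_one)
  then show "V = 0\<^sub>m n 1" using m V by (intro eq_matI) auto
qed

text \<open>With S = m I + A G, the quadratic part of Q is given by M = m G + G A G = G S. Thus F0 =
  S^-1 E solves M F0 = G E, and Q takes the form treated by \<open>psd_quadratic_maximum\<close>. G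
  itself may be singular.\<close>

lemma regularized_quadratic_maximum:
  fixes m :: real
  assumes A: "psd n A" and H: "H \<in> carrier_mat n p" and m: "m > 0"
    and E: "E \<in> carrier_mat n d" and F: "F \<in> carrier_mat n d"
  defines "G \<equiv> H * ctr H"
  defines "Q \<equiv> \<lambda>F. 2 * Re (mtrace (ctr E * (G * F)))
      - Re (mtrace (ctr (G * F) * A * (G * F))) - m * Re (mtrace (ctr F * G * F))"
  shows "Q F \<le> Q (minv (complex_of_real m \<cdot>\<^sub>m 1\<^sub>m n + A * G) * E)"
proof -
  define S where "S = complex_of_real m \<cdot>\<^sub>m 1\<^sub>m n + A * G"
  define M where "M = complex_of_real m \<cdot>\<^sub>m G + ctr G * A * G"
  define F0 where "F0 = minv S * E"
  note Ac = psdD(1,2)[OF A]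
  have Gpsd: "psd n G" using psd_ctr_mult_self[OF ctr_carrier[OF H]] by (simp add: G_def)
  note G = psdD(1,2)[OF Gpsd]
  have S: "S \<in> carrier_mat n n" using Ac G by (simp add: S_def)
  have inv: "invertible_mat S"
    unfolding S_def G_def by (rule invertible_shifted_psd_product[OF A H m])
  note Si = minv[OF S inv]
  have F0: "F0 \<in> carrier_mat n d" using Si E by (simp add: F0_def)
  have Mpsd: "psd n M"
    unfolding M_def using m by (intro psd_add psd_smult psd_congruence[OF A] G Gpsd) auto
  note M = psdD(1,2)[OF Mpsd]
  have MGS: "M = G * S" using Ac(1) G by (simp add: M_def S_def mat_ring_dim)
  have "M * F0 = G * (S * minv S) * E"
    unfolding MGS F0_def using G(1) S Si(1) E by (simp add: mult_assoc_dim)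
  then have "M * F0 = G * E" using Si G by simp
  then have "ctr (M * F0) = ctr (G * E)" by simp
  \<comment> \<open>The adjoint of the stationarity equation turns the linear term Tr (E^H G F) into
    Tr (F0^H M F).\<close>
  then have stat: "ctr F0 * M = ctr E * G" using M F0 G E by (simp add: ctr_mult)
  have Q: "Q X = 2 * Re (mtrace (ctr F0 * M * X)) - Re (mtrace (ctr X * M * X))"
    if X: "X \<in> carrier_mat n d" for X
  proof -
    have "mtrace (ctr X * M * X)
        = m * mtrace (ctr X * G * X) + mtrace (ctr (G * X) * A * (G * X))"
      using X Ac(1) G(1) by (simp add: M_def mat_ring_dim ctr_mult mtrace_add mtrace_smult)
    then show ?thesis
      using X E G(1) by (simp add: Q_def stat mult_assoc_dim)
  qed
  have "Q F \<le> Q F0"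
    unfolding Q[OF F] Q[OF F0] by (rule psd_quadratic_maximum[OF Mpsd F F0])
  then show ?thesis by (simp add: F0_def S_def)
qed

lemma psd_quadratic_real:
  assumes "psd n A" "V \<in> carrier_mat n m"
  shows "mtrace (ctr V * A * V) = of_real (Re (mtrace (ctr V * A * V)))"
  using psd_ctr[OF psd_congruence[OF assms]] by (rule mtrace_hermitian)

section \<open>Block matrices\<close>

definition rowblock :: "nat \<Rightarrow> complex mat \<Rightarrow> nat \<Rightarrow> complex mat" where
  "rowblock r V k = mat r (dim_col V) (\<lambda>(i,j). V $$ (k*r + i, j))"

text \<open>Blocks may be rectangular, so that one construction covers both \<open>Atilde\<close>
  and \<open>Btilde\<close>.\<close>

definition blkdiag :: "nat \<Rightarrow> nat \<Rightarrow> nat \<Rightarrow> (nat \<Rightarrow> complex mat) \<Rightarrow> complex mat" where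
  "blkdiag K r s D = mat (K*r) (K * s)
     (\<lambda>(i,j). if i div r = j div s then D (i div r) $$ (i mod r, j mod s) else 0)"

lemma rowblock_carrier [simp]: "rowblock r V k \<in> carrier_mat r (dim_col V)"
  by (simp add: rowblock_def)

lemma blkdiag_carrier [simp]: "blkdiag K r s D \<in> carrier_mat (K*r) (K * s)"
  by (simp add: blkdiag_def)

lemma colblock_carrier [simp]: "colblock d n F k \<in> carrier_mat n d"
  by (simp add: colblock_def)

lemma block_index_less: "k < K \<Longrightarrow> a < r \<Longrightarrow> k*r + a < K*(r::nat)"
  by (metis add.commute add_less_cancel_left less_le_trans mult_Suc mult_le_mono1 Suc_leI)

text \<open>Splits a flat index into block number and offset, the form in which the
  \<open>div\<close> and \<open>mod\<close> of block entries evaluate.\<close>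

lemma sum_blocks:
  fixes f :: "nat \<Rightarrow> 'a :: comm_monoid_add"
  shows "(\<Sum>i<K*r. f i) = (\<Sum>k<K. \<Sum>a<r. f (k*r + a))"
proof -
  have "sum f {k*r..<k*r+r} = (\<Sum>a<r. f (k*r + a))" for k
    using sum.shift_bounds_nat_ivl[of f 0 "k*r" r] by (simp add: lessThan_atLeast0 add.commute)
  then show ?thesis by (simp add: sum.nat_group[symmetric])
qed

lemma rowblock_mult:
  assumes "P \<in> carrier_mat (K*r) m" "Q \<in> carrier_mat m p" "k < K"
  shows "rowblock r (P * Q) k = rowblock r P k * Q"
  using assms block_index_less[OF assms(3)]
  by (intro eq_matI) (auto simp: rowblock_def scalar_prod_def)

lemma colblock_mult:
  assumes "P \<in> carrier_mat n m" "Q \<in> carrier_mat m (K*d)" "k < K"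
  shows "colblock d n (P * Q) k = P * colblock d m Q k"
  using assms block_index_less[OF assms(3)]
  by (intro eq_matI) (auto simp: colblock_def scalar_prod_def)

lemma blkdiag_quadratic_form:
  assumes D: "\<And>k. k < K \<Longrightarrow> D k \<in> carrier_mat r r" and V: "V \<in> carrier_mat (K*r) m"
  shows "mtrace (ctr V * blkdiag K r r D * V)
       = (\<Sum>k<K. mtrace (ctr (rowblock r V k) * D k * rowblock r V k))"
proof -
  \<comment> \<open>Entries outside the diagonal blocks vanish, so the sum over l collapses to l =
    k.\<close>
  have entry: "cnj (V $$ (k*r+a, c)) * blkdiag K r r D $$ (k*r+a, l*r+b) * V $$ (l*r+b, c)
      = (if l = k then cnj (V $$ (k*r+a, c)) * D k $$ (a,b) * V $$ (k*r+b, c) else 0)"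
    if "k < K" "l < K" "a < r" "b < r" for k l a b c
    using that by (auto simp: blkdiag_def block_index_less)
  have "mtrace (ctr V * blkdiag K r r D * V)
      = (\<Sum>c<m. \<Sum>k<K. \<Sum>a<r. \<Sum>l<K. \<Sum>b<r.
          cnj (V $$ (k*r+a, c)) * blkdiag K r r D $$ (k*r+a, l*r+b) * V $$ (l*r+b, c))"
    unfolding mtrace_quadratic_form[OF blkdiag_carrier V] sum_blocks ..
  also have "\<dots> = (\<Sum>c<m. \<Sum>k<K. \<Sum>a<r. \<Sum>l<K. \<Sum>b<r.
      (if l = k then cnj (V $$ (k*r+a, c)) * D k $$ (a,b) * V $$ (k*r+b, c) else 0))"
    by (intro sum.cong refl entry) auto
  also have "\<dots> = (\<Sum>c<m. \<Sum>k<K. \<Sum>a<r. \<Sum>l<K.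
      (if l = k then \<Sum>b<r. cnj (V $$ (k*r+a, c)) * D k $$ (a,b) * V $$ (k*r+b, c) else 0))"
    by (intro sum.cong refl) auto
  also have "\<dots> = (\<Sum>c<m. \<Sum>k<K. \<Sum>a<r. \<Sum>b<r.
      cnj (V $$ (k*r+a, c)) * D k $$ (a,b) * V $$ (k*r+b, c))"
    by simp
  also have "\<dots> = (\<Sum>k<K. \<Sum>c<m. \<Sum>a<r. \<Sum>b<r.
      cnj (V $$ (k*r+a, c)) * D k $$ (a,b) * V $$ (k*r+b, c))"
    by (rule sum.swap)
  also have "\<dots> = (\<Sum>k<K. mtrace (ctr (rowblock r V k) * D k * rowblock r V k))"
  proof (intro sum.cong refl)
    fix k assume "k \<in> {..<K}"
    then have "D k \<in> carrier_mat r r" using D by simp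
    from mtrace_quadratic_form[OF this rowblock_carrier[of r V k]]
    show "(\<Sum>c<m. \<Sum>a<r. \<Sum>b<r. cnj (V $$ (k*r+a, c)) * D k $$ (a,b) * V $$ (k*r+b, c))
        = mtrace (ctr (rowblock r V k) * D k * rowblock r V k)"
      using V by (simp add: rowblock_def)
  qed
  finally show ?thesis .
qed

lemma psd_blkdiag:
  assumes "\<And>k. k < K \<Longrightarrow> psd r (D k)"
  shows "psd (K*r) (blkdiag K r r D)"
  unfolding psd_def
proof (intro conjI allI impI blkdiag_carrier)
  show "ctr (blkdiag K r r D) = blkdiag K r r D"
  proof (rule eq_matI)
    fix i j assume "i < dim_row (blkdiag K r r D)" "j < dim_col (blkdiag K r r D)"
    then have ij: "i < K*r" "j < K*r" by (auto simp: blkdiag_def)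
    \<comment> \<open>An index below K*r forces r > 0, so remainders modulo r are valid indices into
      a block.\<close>
    then have r: "r > 0" by (cases r) auto
    have "i div r < K" using ij by (simp add: less_mult_imp_div_less)
    from psdD(1,2)[OF assms[OF this]] r
    have "D (i div r) $$ (i mod r, j mod r) = cnj (D (i div r) $$ (j mod r, i mod r))"
      using ctr_index[of "i mod r" "D (i div r)" "j mod r"] by simp
    then show "ctr (blkdiag K r r D) $$ (i,j) = blkdiag K r r D $$ (i,j)"
      using ij by (auto simp: blkdiag_def)
  qed (simp_all add: blkdiag_def)
  fix m and V :: "complex mat" assume "V \<in> carrier_mat (K*r) m"
  then show "0 \<le> Re (mtrace (ctr V * blkdiag K r r D * V))"
    using psd_carrier[OF assms] psd_nonneg[OF assms rowblock_carrier]
    by (auto simp: blkdiag_quadratic_form intro!: sum_nonneg)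
qed

text \<open>The k-th column block of the block-diagonal matrix has D k in its k-th row block and
  zeros elsewhere, so the pairing sees only that row block of W.\<close>

lemma mtrace_colblock_blkdiag:
  assumes D: "D k \<in> carrier_mat r s" and W: "W \<in> carrier_mat (K*r) s" and k: "k < K"
  shows "mtrace (ctr (colblock s (K*r) (blkdiag K r s D) k) * W)
       = mtrace (ctr (D k) * rowblock r W k)"
proof -
  have "mtrace (ctr (colblock s (K*r) (blkdiag K r s D) k) * W)
      = (\<Sum>c<s. \<Sum>l<K. \<Sum>a<r.
          cnj (colblock s (K*r) (blkdiag K r s D) k $$ (l*r+a, c)) * W $$ (l*r+a, c))"
    unfolding mtrace_ctr_mult[OF colblock_carrier W] sum_blocks ..
  also have "\<dots> = (\<Sum>c<s. \<Sum>l<K. \<Sum>a<r. if l = k then cnj (D k $$ (a,c)) * W $$ (k*r+a, c) else 0)"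
    using k by (intro sum.cong refl) (auto simp: colblock_def blkdiag_def block_index_less)
  also have "\<dots> = (\<Sum>c<s. \<Sum>l<K. if l = k then \<Sum>a<r. cnj (D k $$ (a,c)) * W $$ (k*r+a, c) else 0)"
    by (intro sum.cong refl) auto
  also have "\<dots> = (\<Sum>c<s. \<Sum>a<r. cnj (D k $$ (a,c)) * W $$ (k*r+a, c))"
    using k by simp
  also have "\<dots> = mtrace (ctr (D k) * rowblock r W k)"
    using D W by (subst mtrace_ctr_mult[of _ r s]) (auto simp: rowblock_def)
  finally show ?thesis .
qed

section \<open>The surrogate objective\<close>

locale precoder =
  fixes K Nt Nr Nd :: nat and c :: real and \<omega> :: "nat \<Rightarrow> real" and Hs Fn :: "nat \<Rightarrow> complex mat"
  assumes c_pos: "c > 0" and \<omega>_pos: "\<And>k. k < K \<Longrightarrow> \<omega> k > 0"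
    and Hs_carrier: "\<And>k. k < K \<Longrightarrow> Hs k \<in> carrier_mat Nr Nt"
    and Fn_carrier: "\<And>k. k < K \<Longrightarrow> Fn k \<in> carrier_mat (K*Nr) Nd"
    and Y_invertible: "\<And>k. k < K \<Longrightarrow> invertible_mat (Yhat K Nr Nt Hs c Fn k)"
begin

abbreviation "n \<equiv> K*Nr"
abbreviation "H \<equiv> Hstack K Nr Nt Hs"
abbreviation "G \<equiv> Hbar K Nr Nt Hs"
abbreviation "Gk \<equiv> Hbark K Nr Nt Hs"
abbreviation "X \<equiv> Xhat K Nr Nt Hs Fn"
abbreviation "Y \<equiv> Yhat K Nr Nt Hs c Fn"
abbreviation "A \<equiv> Ahat K Nr Nt Hs c Fn"
abbreviation "B \<equiv> Bhat K Nr Nt Hs c Fn"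
abbreviation "At \<equiv> Atilde K Nr Nt Hs c Fn \<omega>"
abbreviation "Bt \<equiv> Btilde K Nr Nt Nd Hs c Fn \<omega>"

text \<open>Real counterpart of the complex \<open>mu\<close>; they agree because a Hermitian matrix
  has a real trace. A real value is needed to speak of its sign.\<close>

definition \<mu> :: real where "\<mu> = c * (\<Sum>k<K. \<omega> k * Re (mtrace (A k)))"

section \<open>The Gram matrix of the stacked channel\<close>

lemma H_carrier: "H \<in> carrier_mat n Nt"
  by (simp add: Hstack_def)

lemma psd_G: "psd n G"
  using psd_ctr_mult_self[OF ctr_carrier[OF H_carrier]] by (simp add: Hbar_def)

lemmas G_carrier = psd_carrier[OF psd_G]

lemma Gk_carrier: "k < K \<Longrightarrow> Gk k \<in> carrier_mat Nr n"
  unfolding Hbark_def by (rule mult_carrier_mat[OF Hs_carrier ctr_carrier[OF H_carrier]])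

text \<open>The k-th row block of H H^H is H_k H^H. This is the link between the stacked closed form
  and the terms of each user.\<close>

lemma rowblock_G:
  assumes "k < K"
  shows "rowblock Nr G k = Gk k"
proof -
  have "rowblock Nr H k = Hs k"
    using Hs_carrier[OF assms] block_index_less[OF assms]
    by (intro eq_matI) (auto simp: rowblock_def Hstack_def)
  then show ?thesis
    unfolding Hbar_def Hbark_def
    using rowblock_mult[OF H_carrier ctr_carrier[OF H_carrier] assms] by simp
qed

lemma rowblock_G_mult:
  "F \<in> carrier_mat n d \<Longrightarrow> k < K \<Longrightarrow> rowblock Nr (G * F) k = Gk k * F"
  by (simp add: rowblock_mult[OF G_carrier] rowblock_G)

text \<open>Cyclicity turns the power term into a quadratic form of G, which is real because G is
  Hermitian.\<close>

lemma mtrace_G_mult_ctr: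
  assumes "F \<in> carrier_mat n d"
  shows "mtrace (G * F * ctr F) = of_real (Re (mtrace (ctr F * G * F)))"
proof -
  have "mtrace (G * F * ctr F) = mtrace (ctr F * (G * F))"
    using assms G_carrier by (intro mtrace_mult_commute) auto
  also have "\<dots> = mtrace (ctr F * G * F)"
    using assms G_carrier by (simp add: mult_assoc_dim)
  also note psd_quadratic_real[OF psd_G assms]
  finally show ?thesis .
qed

section \<open>Positivity of Y_k and A_k\<close>

lemma X_carrier: "k < K \<Longrightarrow> X k \<in> carrier_mat Nr Nd"
  unfolding Xhat_def by (rule mult_carrier_mat[OF Gk_carrier Fn_carrier])

lemma psd_Y:
  assumes k: "k < K"
  shows "psd Nr (Y k)"
proof -
  have 1: "psd Nr (Gk k * Fn j * ctr (Fn j) * ctr (Gk k))" if "j < K" for j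
  proof -
    have "Gk k * Fn j * ctr (Fn j) * ctr (Gk k) = ctr (ctr (Gk k * Fn j)) * ctr (Gk k * Fn j)"
      using Gk_carrier[OF k] Fn_carrier[OF that] by (simp add: ctr_mult mult_assoc_dim)
    then show ?thesis
      using psd_ctr_mult_self[OF ctr_carrier[OF mult_carrier_mat[OF Gk_carrier[OF k] Fn_carrier[OF that]]]]
      by simp
  qed
  \<comment> \<open>The factor of the identity in \<open>Yhat\<close> is a complex expression; it
    equals the real number c * p, and p is nonnegative because G is positive semidefinite.\<close>
  define p where "p = (\<Sum>i<K. Re (mtrace (ctr (Fn i) * G * Fn i)))"
  have p: "complex_of_real c * (\<Sum>i<K. mtrace (G * Fn i * ctr (Fn i))) = complex_of_real (c * p)"
    using mtrace_G_mult_ctr[OF Fn_carrier] by (simp add: p_def)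
  have "p \<ge> 0"
    unfolding p_def using psd_nonneg[OF psd_G Fn_carrier] by (intro sum_nonneg) auto
  then have "c * p \<ge> 0" using c_pos by simp
  then show ?thesis
    unfolding Yhat_def p
    by (intro psd_add psd_msum psd_smult psd_one 1) auto
qed

lemmas Y_carrier = psd_carrier[OF psd_Y]

lemma psd_A: "k < K \<Longrightarrow> psd Nr (A k)"
  unfolding Ahat_def by (rule psd_minv_diff(1)[OF psd_Y Y_invertible X_carrier])

lemma X_eq_0: "k < K \<Longrightarrow> Re (mtrace (A k)) \<le> 0 \<Longrightarrow> X k = 0\<^sub>m Nr Nd"
  unfolding Ahat_def by (rule psd_minv_diff(2)[OF psd_Y Y_invertible X_carrier])

lemma B_carrier: "k < K \<Longrightarrow> B k \<in> carrier_mat Nd Nr"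
  unfolding Bhat_def
  by (rule mult_carrier_mat[OF ctr_carrier[OF X_carrier] minv_carrier[OF Y_carrier Y_invertible]])

section \<open>Block-diagonal form of the coefficients, and the sign of \<mu>\<close>

lemma Atilde_blkdiag: "At = blkdiag K Nr Nr (\<lambda>k. of_real (\<omega> k) \<cdot>\<^sub>m A k)"
proof (rule eq_matI)
  fix i j assume "i < dim_row (blkdiag K Nr Nr (\<lambda>k. of_real (\<omega> k) \<cdot>\<^sub>m A k))"
    "j < dim_col (blkdiag K Nr Nr (\<lambda>k. of_real (\<omega> k) \<cdot>\<^sub>m A k))"
  then have ij: "i < n" "j < n" by (auto simp: blkdiag_def)
  then have r: "Nr > 0" by (cases Nr) auto
  have k: "i div Nr < K" using ij by (simp add: less_mult_imp_div_less)
  show "At $$ (i,j) = blkdiag K Nr Nr (\<lambda>k. of_real (\<omega> k) \<cdot>\<^sub>m A k) $$ (i,j)"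
    \<comment> \<open>Each A_k is Hermitian, so the conjugate transposes in \<open>Atilde\<close>
      disappear.\<close>
    using ij r psdD(1,2)[OF psd_A[OF k]]
    by (cases "i div Nr = j div Nr") (simp_all add: Atilde_def blkdiag_def)
qed (simp_all add: blkdiag_def Atilde_def)

lemma Btilde_blkdiag: "Bt = blkdiag K Nr Nd (\<lambda>k. of_real (\<omega> k) \<cdot>\<^sub>m ctr (B k))"
proof (rule eq_matI)
  fix i j assume "i < dim_row (blkdiag K Nr Nd (\<lambda>k. of_real (\<omega> k) \<cdot>\<^sub>m ctr (B k)))"
    "j < dim_col (blkdiag K Nr Nd (\<lambda>k. of_real (\<omega> k) \<cdot>\<^sub>m ctr (B k)))"
  then have ij: "i < n" "j < K * Nd" by (auto simp: blkdiag_def)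
  then have r: "Nr > 0" "Nd > 0" by (auto intro!: gr0I)
  have k: "i div Nr < K" using ij by (simp add: less_mult_imp_div_less)
  show "Bt $$ (i,j) = blkdiag K Nr Nd (\<lambda>k. of_real (\<omega> k) \<cdot>\<^sub>m ctr (B k)) $$ (i,j)"
    using ij r B_carrier[OF k]
    by (cases "i div Nr = j div Nd") (simp_all add: Btilde_def blkdiag_def)
qed (simp_all add: blkdiag_def Btilde_def)

lemma psd_Atilde: "psd n At"
  unfolding Atilde_blkdiag using psd_A \<omega>_pos by (intro psd_blkdiag psd_smult) (auto simp: less_imp_le)

lemma mu_eq_\<mu>: "mu K Nr Nt Hs c Fn \<omega> = of_real \<mu>"
proof -
  have "mtrace (ctr (A k)) = of_real (Re (mtrace (A k)))" if "k < K" for k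
    unfolding psd_ctr[OF psd_A[OF that]] by (rule mtrace_hermitian[OF psd_ctr[OF psd_A[OF that]]])
  then show ?thesis by (simp add: mu_def \<mu>_def)
qed

lemma \<mu>_nonneg: "\<mu> \<ge> 0"
  unfolding \<mu>_def
proof (intro mult_nonneg_nonneg sum_nonneg)
  fix k assume "k \<in> {..<K}"
  then show "0 \<le> \<omega> k" "0 \<le> Re (mtrace (A k))"
    using \<omega>_pos psd_mtrace_nonneg[OF psd_A] by (auto simp: less_imp_le)
qed (use c_pos in simp)

text \<open>A vanishing sum of nonnegative terms has only zero terms; as the weights are positive,
  every trace Tr A_k is 0.\<close>

lemma X_eq_0_if_\<mu>_eq_0:
  assumes "\<mu> = 0" "k < K"
  shows "X k = 0\<^sub>m Nr Nd"
proof -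
  have "\<forall>l\<in>{..<K}. 0 \<le> \<omega> l * Re (mtrace (A l))"
    using \<omega>_pos psd_mtrace_nonneg[OF psd_A] by (auto simp: less_imp_le)
  moreover have "(\<Sum>l<K. \<omega> l * Re (mtrace (A l))) = 0"
    using assms(1) c_pos by (simp add: \<mu>_def)
  ultimately have "\<omega> k * Re (mtrace (A k)) = 0"
    using assms(2) sum_nonneg_0[of "{..<K}" "\<lambda>l. \<omega> l * Re (mtrace (A l))" k] by simp
  then show ?thesis using \<omega>_pos[OF assms(2)] X_eq_0[OF assms(2)] by simp
qed

section \<open>Decoupling of the objective\<close>

definition offset :: "nat \<Rightarrow> real" where
  "offset k = Re (Ln (det (1\<^sub>m Nd + B k * X k)) - mtrace (B k * X k))"

lemma Re_gk:
  assumes k: "k < K" and F: "\<And>j. j < K \<Longrightarrow> F j \<in> carrier_mat n Nd"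
  shows "Re (gk K Nr Nt Nd Hs c Fn k F) = offset k + 2 * Re (mtrace (B k * (Gk k * F k)))
    - (\<Sum>j<K. Re (mtrace (ctr (Gk k * F j) * A k * (Gk k * F j))))
    - c * Re (mtrace (A k)) * (\<Sum>i<K. Re (mtrace (ctr (F i) * G * F i)))"
proof -
  note Ac = psdD(1,2)[OF psd_A[OF k]] and Gkc = Gk_carrier[OF k]
  have 1: "B k * Gk k * F k = B k * (Gk k * F k)"
    using B_carrier[OF k] Gkc F[OF k] by (simp add: mult_assoc_dim)
  have 2: "(\<Sum>j<K. mtrace (ctr (F j) * ctr (Gk k) * A k * Gk k * F j))
      = (\<Sum>j<K. mtrace (ctr (Gk k * F j) * A k * (Gk k * F j)))"
  proof (intro sum.cong refl)
    fix j assume "j \<in> {..<K}"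
    then have "F j \<in> carrier_mat n Nd" using F by simp
    then show "mtrace (ctr (F j) * ctr (Gk k) * A k * Gk k * F j)
        = mtrace (ctr (Gk k * F j) * A k * (Gk k * F j))"
      using Ac Gkc by (simp add: ctr_mult mult_assoc_dim)
  qed
  have 3: "(\<Sum>i<K. mtrace (G * F i * ctr (F i))) = of_real (\<Sum>i<K. Re (mtrace (ctr (F i) * G * F i)))"
    using mtrace_G_mult_ctr[OF F] by simp
  show ?thesis
    unfolding gk_def Let_def Ac(2) 1 2 3 offset_def by simp
qed

text \<open>The part of the weighted sum that involves the precoder of user k, written as the
  quadratic Q of \<open>regularized_quadratic_maximum\<close> with E the k-th column block of
  \<open>Bt\<close>.\<close>

definition surrogate :: "nat \<Rightarrow> complex mat \<Rightarrow> real" where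
  "surrogate k F = 2 * Re (mtrace (ctr (colblock Nd n Bt k) * (G * F)))
     - Re (mtrace (ctr (G * F) * At * (G * F))) - \<mu> * Re (mtrace (ctr F * G * F))"

text \<open>Each g_k involves all precoders. Collecting the terms by precoder separates the
  variables: for fixed F_j, the weighted quadratic terms over all k assemble into one form of
  \<open>At\<close>, and the power terms add up to \<mu>.\<close>

lemma Re_objective:
  assumes F: "\<And>j. j < K \<Longrightarrow> F j \<in> carrier_mat n Nd"
  shows "Re (objective K Nr Nt Nd Hs c Fn \<omega> F)
    = (\<Sum>k<K. \<omega> k * offset k) + (\<Sum>k<K. surrogate k (F k))"
proof -
  have lin: "Re (mtrace (ctr (colblock Nd n Bt k) * (G * F k)))
      = \<omega> k * Re (mtrace (B k * (Gk k * F k)))" if k: "k < K" for k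
  proof -
    have "mtrace (ctr (colblock Nd n Bt k) * (G * F k))
        = mtrace (ctr (of_real (\<omega> k) \<cdot>\<^sub>m ctr (B k)) * rowblock Nr (G * F k) k)"
      unfolding Btilde_blkdiag using k F[OF k] G_carrier B_carrier[OF k]
      by (intro mtrace_colblock_blkdiag) auto
    also have "\<dots> = of_real (\<omega> k) * mtrace (B k * (Gk k * F k))"
      using k F[OF k] Gk_carrier[OF k] B_carrier[OF k]
      by (simp add: rowblock_G_mult ctr_smult smult_mult_dim mtrace_smult)
    finally show ?thesis by simp
  qed
  have quad: "Re (mtrace (ctr (G * F j) * At * (G * F j)))
      = (\<Sum>k<K. \<omega> k * Re (mtrace (ctr (Gk k * F j) * A k * (Gk k * F j))))" if j: "j < K" for j
  proof -
    have "mtrace (ctr (G * F j) * At * (G * F j))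
        = (\<Sum>k<K. mtrace (ctr (rowblock Nr (G * F j) k) * (of_real (\<omega> k) \<cdot>\<^sub>m A k) * rowblock Nr (G * F j) k))"
      unfolding Atilde_blkdiag using F[OF j] G_carrier psd_carrier[OF psd_A]
      by (intro blkdiag_quadratic_form[of K _ Nr _ Nd]) auto
    also have "\<dots> = (\<Sum>k<K. of_real (\<omega> k) * mtrace (ctr (Gk k * F j) * A k * (Gk k * F j)))"
    proof (intro sum.cong refl)
      fix k assume "k \<in> {..<K}"
      then have k: "k < K" by simp
      show "mtrace (ctr (rowblock Nr (G * F j) k) * (of_real (\<omega> k) \<cdot>\<^sub>m A k) * rowblock Nr (G * F j) k)
          = of_real (\<omega> k) * mtrace (ctr (Gk k * F j) * A k * (Gk k * F j))"
        using F[OF j] Gk_carrier[OF k] psd_carrier[OF psd_A[OF k]]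
        by (simp add: rowblock_G_mult[OF F[OF j] k] mult_smult_dim smult_mult_dim mtrace_smult)
    qed
    finally show ?thesis by simp
  qed
  define p where "p i = Re (mtrace (ctr (F i) * G * F i))" for i
  define q where "q k j = Re (mtrace (ctr (Gk k * F j) * A k * (Gk k * F j)))" for k j
  define l where "l k = Re (mtrace (B k * (Gk k * F k)))" for k
  have "Re (objective K Nr Nt Nd Hs c Fn \<omega> F) = (\<Sum>k<K. \<omega> k * Re (gk K Nr Nt Nd Hs c Fn k F))"
    by (simp add: objective_def)
  also have "\<dots> = (\<Sum>k<K. \<omega> k * (offset k + 2 * l k - (\<Sum>j<K. q k j)
      - c * Re (mtrace (A k)) * (\<Sum>i<K. p i)))"
    by (intro sum.cong refl) (simp add: Re_gk[OF _ F] p_def q_def l_def)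
  also have "\<dots> = (\<Sum>k<K. \<omega> k * offset k) + (\<Sum>k<K. 2 * (\<omega> k * l k))
      - (\<Sum>k<K. \<Sum>j<K. \<omega> k * q k j) - \<mu> * (\<Sum>i<K. p i)"
    by (simp add: \<mu>_def algebra_simps sum.distrib sum_subtractf sum_distrib_left sum_distrib_right)
  \<comment> \<open>Here the order changes from grouping by the function g_k to grouping by the
    precoder F_j.\<close>
  also have "(\<Sum>k<K. \<Sum>j<K. \<omega> k * q k j) = (\<Sum>j<K. \<Sum>k<K. \<omega> k * q k j)"
    by (rule sum.swap)
  also have "(\<Sum>k<K. \<omega> k * offset k) + (\<Sum>k<K. 2 * (\<omega> k * l k))
      - (\<Sum>j<K. \<Sum>k<K. \<omega> k * q k j) - \<mu> * (\<Sum>i<K. p i)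
      = (\<Sum>k<K. \<omega> k * offset k) + (\<Sum>j<K. 2 * (\<omega> j * l j) - (\<Sum>k<K. \<omega> k * q k j) - \<mu> * p j)"
    by (simp add: sum_subtractf sum_distrib_left)
  also have "(\<Sum>j<K. 2 * (\<omega> j * l j) - (\<Sum>k<K. \<omega> k * q k j) - \<mu> * p j) = (\<Sum>j<K. surrogate j (F j))"
    by (intro sum.cong refl) (simp add: surrogate_def lin quad p_def q_def l_def)
  finally show ?thesis .
qed

text \<open>X_k = 0 gives B_k = 0 and A_k = Y_k^-1 - Y_k^-1 = 0, so every term containing F
  vanishes.\<close>

lemma Re_objective_if_\<mu>_eq_0:
  assumes "\<mu> = 0" and F: "\<And>j. j < K \<Longrightarrow> F j \<in> carrier_mat n Nd"
  shows "Re (objective K Nr Nt Nd Hs c Fn \<omega> F) = (\<Sum>k<K. \<omega> k * offset k)"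
proof -
  have "Re (gk K Nr Nt Nd Hs c Fn k F) = offset k" if k: "k < K" for k
  proof -
    note X0 = X_eq_0_if_\<mu>_eq_0[OF assms(1) k]
    have Bk: "B k = 0\<^sub>m Nd Nr"
      using minv_carrier[OF Y_carrier[OF k] Y_invertible[OF k]] by (simp add: Bhat_def X0)
    have Ak: "A k = 0\<^sub>m Nr Nr"
      using minv_carrier[OF Y_carrier[OF k] Y_invertible[OF k]] Y_carrier[OF k]
      by (simp add: Ahat_def X0)
    have "mtrace (ctr (Gk k * F j) * A k * (Gk k * F j)) = 0" if "j < K" for j
    proof -
      have W: "Gk k * F j \<in> carrier_mat Nr Nd"
        by (rule mult_carrier_mat[OF Gk_carrier[OF k] F[OF that]])
      show ?thesis
        unfolding Ak right_mult_zero_mat[OF ctr_carrier[OF W]] left_mult_zero_mat[OF W] by simp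
    qed
    moreover have "mtrace (B k * (Gk k * F k)) = 0"
    proof -
      have W: "Gk k * F k \<in> carrier_mat Nr Nd"
        by (rule mult_carrier_mat[OF Gk_carrier[OF k] F[OF k]])
      show ?thesis unfolding Bk left_mult_zero_mat[OF W] by simp
    qed
    ultimately show ?thesis using Re_gk[OF k F] by (simp add: Ak)
  qed
  then show ?thesis by (simp add: objective_def)
qed

lemma objective_le:
  assumes F: "\<And>j. j < K \<Longrightarrow> F j \<in> carrier_mat n Nd"
  shows "Re (objective K Nr Nt Nd Hs c Fn \<omega> F)
    \<le> Re (objective K Nr Nt Nd Hs c Fn \<omega> (colblock Nd n (Fsol K Nr Nt Nd Hs c Fn \<omega>)))"
proof (cases "\<mu> = 0")
  case True
  \<comment> \<open>The closed form may rest on the default value of \<open>minv\<close> here, but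
    \<open>colblock\<close> always returns matrices of the right shape, and on these the objective
    is constant.\<close>
  then show ?thesis using Re_objective_if_\<mu>_eq_0 F by simp
next
  case False
  then have \<mu>: "\<mu> > 0" using \<mu>_nonneg by simp
  define S where "S = complex_of_real \<mu> \<cdot>\<^sub>m 1\<^sub>m n + At * G"
  have S: "S \<in> carrier_mat n n" using G_carrier psd_carrier[OF psd_Atilde] by (simp add: S_def)
  have "invertible_mat S"
    unfolding S_def Hbar_def by (rule invertible_shifted_psd_product[OF psd_Atilde H_carrier \<mu>])
  note Si = minv_carrier[OF S this]
  \<comment> \<open>Left multiplication acts on each column block separately, so the stacked
    solution consists of the maximizers for the individual users.\<close>
  have sol: "colblock Nd n (Fsol K Nr Nt Nd Hs c Fn \<omega>) k = minv S * colblock Nd n Bt k" if "k < K" for k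
    unfolding Fsol_def mu_eq_\<mu> S_def[symmetric]
    by (rule colblock_mult[OF Si _ that]) (simp add: Btilde_def)
  have "surrogate k (F k) \<le> surrogate k (minv S * colblock Nd n Bt k)" if "k < K" for k
    unfolding surrogate_def S_def Hbar_def
    by (rule regularized_quadratic_maximum[OF psd_Atilde H_carrier \<mu> colblock_carrier F[OF that]])
  then have "(\<Sum>k<K. surrogate k (F k))
      \<le> (\<Sum>k<K. surrogate k (colblock Nd n (Fsol K Nr Nt Nd Hs c Fn \<omega>) k))"
    using sol by (intro sum_mono) simp
  then show ?thesis using Re_objective[OF F] Re_objective[OF colblock_carrier] by simp
qed

end

theorem theorem1:
  fixes K Nt Nr Nd :: nat
    and sigma2 P_BS :: real
    and \<omega> :: "nat \<Rightarrow> real"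
    and Hs Fn :: "nat \<Rightarrow> complex mat"
  assumes "K \<ge> 1" and "Nt \<ge> 1" and "Nr \<ge> 1" and "Nd \<ge> 1"
    and "sigma2 > 0" and "P_BS > 0"
    and "\<forall>k<K. \<omega> k > 0" and "(\<Sum>k<K. \<omega> k) = 1"
    and "\<forall>k<K. Hs k \<in> carrier_mat Nr Nt"
    and "\<forall>k<K. Fn k \<in> carrier_mat (K*Nr) Nd"
    and "\<forall>k<K. invertible_mat (Yhat K Nr Nt Hs (sigma2 / P_BS) Fn k)"
  shows "\<forall>F. (\<forall>k<K. F k \<in> carrier_mat (K*Nr) Nd) \<longrightarrow>
           Re (objective K Nr Nt Nd Hs (sigma2 / P_BS) Fn \<omega> F)
           \<le> Re (objective K Nr Nt Nd Hs (sigma2 / P_BS) Fn \<omega>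
                   (colblock Nd (K*Nr) (Fsol K Nr Nt Nd Hs (sigma2 / P_BS) Fn \<omega>)))"
proof -
  interpret precoder K Nt Nr Nd "sigma2 / P_BS" \<omega> Hs Fn
    using assms by unfold_locales simp_all
  show ?thesis using objective_le by blast
qed

end
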